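(* Let $M$ be a boolean matrix representation of a simple simplicial complex $\mathcal{H}=(V,H)$ of dimension $2$. Then: (i) if $\Gamma M$ is connected or belongs to $\Omega_1\cup\Omega_2$, then $\Gamma\mathrm{Fl}\mathcal{H}$ is connected; (ii) in all other cases, $\Gamma\mathrm{Fl}\mathcal{H}=\Gamma M$.
   Context: A (finite) simplicial complex is a pair $(V,H)$ with $V$ finite nonempty and $H\subseteq 2^V$ containing all singletons and closed under subsets; it is simple if every 2-subset of $V$ is in $H$; dimension of a face $I$ is $|I|-1$, of the complex the maximum over faces. A boolean matrix with row set $R$ and column set $V$ is nonsingular if, after independently permuting rows and columns, it is square lower unitriangular; $X\subseteq V$ is $M$-independent if some submatrix $M[Y,X]$ is nonsingular; $M=(m_{rv})$ is a boolean matrix representation of $\mathcal{H}$ if $H$ is exactly the set of $M$-independent subsets. For a row $r$, $Z_r=\{v\in V: m_{rv}=0\}$; $Z_r$ is a line of $M$ if $2\leq|Z_r|<|V|$. $\Gamma M$ is the graph with vertex set $V$ and an edge $p - q$ whenever $\{p,q\}$ is a 2-subset of some line of $M$. A flat of $\mathcal{H}$ is a set $X\subseteq V$ with $I\cup\{p\}\in H$ for all $I\in H$, $I\subseteq X$, $p\in V\setminus X$; $\overline{X}$ is the intersection of flats containing $X$. $\Gamma\mathrm{Fl}\mathcal{H}$ has vertex set $V$ and edges $p - q$ for $p\neq q$ with $\overline{\{p,q\}}\neq V$. For disjoint graphs $\Gamma,\Gamma'$, the join $\Gamma+\Gamma'$ is their union together with all edges between a vertex of $\Gamma$ and a vertex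 of $\Gamma'$, and the coproduct $\Gamma\sqcup\Gamma'$ is their disjoint union. $K_n$ is the complete graph on $n$ vertices and $\overline{K_n}$ the edgeless graph on $n$ vertices. $\Omega_1$ is the class of graphs of the form $(\overline{K_n}+\Delta)\sqcup K_1$ with $n\geq 1$ and $\Delta$ any finite graph; $\Omega_2$ is the class of graphs of the form $(K_1+\Delta)\sqcup(K_1+\Delta')$ with $\Delta,\Delta'$ any finite graphs. *)

theory Defs
  imports "Graph_Theory.Graph_Theory"
begin

section \<open>Simplicial complexes\<close>

definition simplicial_complex :: "'v set \<Rightarrow> 'v set set \<Rightarrow> bool" where
  "simplicial_complex V H \<longleftrightarrow>
     finite V \<and> V \<noteq> {} \<and> H \<subseteq> Pow V \<and> (\<forall>v\<in>V. {v} \<in> H) \<and>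
     (\<forall>I\<in>H. \<forall>J. J \<subseteq> I \<longrightarrow> J \<in> H)"

definition simple_complex :: "'v set \<Rightarrow> 'v set set \<Rightarrow> bool" where
  "simple_complex V H \<longleftrightarrow>
     simplicial_complex V H \<and> (\<forall>X. X \<subseteq> V \<and> card X = 2 \<longrightarrow> X \<in> H)"

text \<open>Integer-valued, since the empty face has dimension \<open>-1\<close>.\<close>

definition face_dim :: "'v set \<Rightarrow> int" where
  "face_dim I = int (card I) - 1"

definition complex_dim :: "'v set set \<Rightarrow> int" where
  "complex_dim H = Max (face_dim ` H)"

definition is_flat :: "'v set \<Rightarrow> 'v set set \<Rightarrow> 'v set \<Rightarrow> bool" where
  "is_flat V H X \<longleftrightarrow>
     X \<subseteq> V \<and> (\<forall>I\<in>H. I \<subseteq> X \<longrightarrow> (\<forall>p\<in>V - X. I \<union> {p} \<in> H))"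

definition flat_closure :: "'v set \<Rightarrow> 'v set set \<Rightarrow> 'v set \<Rightarrow> 'v set" where
  "flat_closure V H X = \<Inter>{F. is_flat V H F \<and> X \<subseteq> F}"


section \<open>Boolean matrices\<close>

text \<open>
  A boolean matrix with row set \<open>R\<close> and column set \<open>V\<close> is a function
  \<open>M :: 'r \<Rightarrow> 'v \<Rightarrow> bool\<close> considered on \<open>R \<times> V\<close> only; the entry \<open>M r v\<close> is
  1 if it is \<open>True\<close> and 0 if it is \<open>False\<close>.
  Distinct rows may have equal entries.
\<close>

text \<open>
  The enumerations \<open>y\<close> and \<open>x\<close> are the independent permutations of the rows and the columns
  that turn \<open>M[Y,X]\<close> into a lower unitriangular matrix: 1 on the diagonal, 0 above it, and
  arbitrary entries below it.
\<close>

definition nonsingular_submatrix :: "('r \<Rightarrow> 'v \<Rightarrow> bool) \<Rightarrow> 'r set \<Rightarrow> 'v set \<Rightarrow> bool" where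
  "nonsingular_submatrix M Y X \<longleftrightarrow>
     (\<exists>(n::nat) y x. bij_betw y {..<n} Y \<and> bij_betw x {..<n} X \<and>
        (\<forall>i<n. M (y i) (x i)) \<and>
        (\<forall>i<n. \<forall>j<n. i < j \<longrightarrow> \<not> M (y i) (x j)))"

definition matrix_independent ::
    "'r set \<Rightarrow> 'v set \<Rightarrow> ('r \<Rightarrow> 'v \<Rightarrow> bool) \<Rightarrow> 'v set \<Rightarrow> bool" where
  "matrix_independent R V M X \<longleftrightarrow>
     X \<subseteq> V \<and> (\<exists>Y. Y \<subseteq> R \<and> nonsingular_submatrix M Y X)"

definition boolean_matrix_representation ::
    "'r set \<Rightarrow> 'v set \<Rightarrow> ('r \<Rightarrow> 'v \<Rightarrow> bool) \<Rightarrow> 'v set set \<Rightarrow> bool" where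
  "boolean_matrix_representation R V M H \<longleftrightarrow>
     finite R \<and> H = {X. matrix_independent R V M X}"

definition zero_set :: "'v set \<Rightarrow> ('r \<Rightarrow> 'v \<Rightarrow> bool) \<Rightarrow> 'r \<Rightarrow> 'v set" where
  "zero_set V M r = {v \<in> V. \<not> M r v}"

definition matrix_lines :: "'r set \<Rightarrow> 'v set \<Rightarrow> ('r \<Rightarrow> 'v \<Rightarrow> bool) \<Rightarrow> 'v set set" where
  "matrix_lines R V M =
     {zero_set V M r | r. r \<in> R \<and> 2 \<le> card (zero_set V M r) \<and> card (zero_set V M r) < card V}"


section \<open>Graphs\<close>

text \<open>
  A finite simple graph is a \<^const>\<open>pair_graph\<close>; an edge \<open>p - q\<close> is the pair of arcs
  \<open>(p,q)\<close> and \<open>(q,p)\<close>. The graph without vertices is a \<^const>\<open>pair_graph\<close>, but it is not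
  connected.
\<close>

definition matrix_graph ::
    "'r set \<Rightarrow> 'v set \<Rightarrow> ('r \<Rightarrow> 'v \<Rightarrow> bool) \<Rightarrow> 'v pair_pre_digraph" where
  "matrix_graph R V M =
     \<lparr> pverts = V, parcs = {(p, q). p \<noteq> q \<and> (\<exists>L\<in>matrix_lines R V M. {p, q} \<subseteq> L)} \<rparr>"

definition flat_graph :: "'v set \<Rightarrow> 'v set set \<Rightarrow> 'v pair_pre_digraph" where
  "flat_graph V H =
     \<lparr> pverts = V,
       parcs = {(p, q). p \<in> V \<and> q \<in> V \<and> p \<noteq> q \<and> flat_closure V H {p, q} \<noteq> V} \<rparr>"

definition edgeless_graph :: "nat \<Rightarrow> 'v pair_pre_digraph \<Rightarrow> bool" where
  "edgeless_graph n G \<longleftrightarrow> pair_graph G \<and> card (pverts G) = n \<and> parcs G = {}"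

definition disjoint_graphs :: "'v pair_pre_digraph \<Rightarrow> 'v pair_pre_digraph \<Rightarrow> bool" where
  "disjoint_graphs G G' \<longleftrightarrow> pverts G \<inter> pverts G' = {}"

text \<open>The next two operations are only used on disjoint graphs.\<close>

definition graph_coproduct ::
    "'v pair_pre_digraph \<Rightarrow> 'v pair_pre_digraph \<Rightarrow> 'v pair_pre_digraph" where
  "graph_coproduct G G' =
     \<lparr> pverts = pverts G \<union> pverts G', parcs = parcs G \<union> parcs G' \<rparr>"

definition graph_join ::
    "'v pair_pre_digraph \<Rightarrow> 'v pair_pre_digraph \<Rightarrow> 'v pair_pre_digraph" where
  "graph_join G G' =
     \<lparr> pverts = pverts G \<union> pverts G',
       parcs = parcs G \<union> parcs G' \<union> pverts G \<times> pverts G' \<union> pverts G' \<times> pverts G \<rparr>"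

text \<open>
  As the constituents range over all graphs with the given shape on arbitrary disjoint vertex sets
  in the type \<open>'v\<close>, both classes are closed under isomorphism.
\<close>

definition Omega1 :: "'v pair_pre_digraph set" where
  "Omega1 = {graph_coproduct (graph_join N D) P | n N D P.
     n \<ge> 1 \<and> edgeless_graph n N \<and> pair_graph D \<and> complete_digraph 1 (with_proj P) \<and>
     disjoint_graphs N D \<and> disjoint_graphs (graph_join N D) P}"

definition Omega2 :: "'v pair_pre_digraph set" where
  "Omega2 = {graph_coproduct (graph_join P D) (graph_join P' D') | P D P' D'.
     complete_digraph 1 (with_proj P) \<and> pair_graph D \<and>
     complete_digraph 1 (with_proj P') \<and> pair_graph D' \<and>
     disjoint_graphs P D \<and> disjoint_graphs P' D' \<and>
     disjoint_graphs (graph_join P D) (graph_join P' D')}"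

end

theory Submission
  imports Defs
begin

text \<open>
  Since the complex has dimension two, a line contains no face with three vertices, so distinct lines
  meet in at most one vertex, and a triple is a face iff some line contains exactly two of its
  vertices. Every line is a flat, hence \<open>\<Gamma>M\<close> is a subgraph of \<open>\<Gamma>Fl\<close>. A proper flat with two
  vertices on no common line is an anticlique of \<open>\<Gamma>M\<close> such that every vertex outside is adjacent
  to all but at most one of its vertices, and conversely. A disconnected graph with an edge has such
  an anticlique exactly when it lies in \<open>\<Omega>\<^sub>1 \<union> \<Omega>\<^sub>2\<close>, and turning the anticlique into a clique
  connects the graph.
\<close>

section \<open>Dominating anticliques\<close>

lemma connected_pair_graph_iff:
  assumes "pair_graph G"
  shows "Digraph_Component.connected (with_proj G) \<longleftrightarrow>
    pverts G \<noteq> {} \<and> (\<forall>u\<in>pverts G. \<forall>v\<in>pverts G. (u, v) \<in> (parcs G)\<^sup>*)"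
proof -
  interpret pair_graph G by fact
  \<comment> \<open>The arcs are already symmetric, so symmetrizing leaves reachability unchanged.
    The start has to be a vertex because \<open>(parcs G)\<^sup>*\<close> is reflexive outside the
    graph as well.\<close>
  have "u \<rightarrow>\<^sup>*\<^bsub>with_proj (mk_symmetric (with_proj G))\<^esub> v \<longleftrightarrow> (u, v) \<in> (parcs G)\<^sup>*"
    if "u \<in> pverts G" for u v
    using reachable_mk_symmetric_eq[OF pair_sym_arcs] reachable_conv'[OF that] by simp
  then show ?thesis
    unfolding connected_def strongly_connected_def by auto
qed

lemma pair_graphI:
  assumes "finite (pverts G)" and "parcs G \<subseteq> pverts G \<times> pverts G"
    and "sym (parcs G)" and "irrefl (parcs G)"
  shows "pair_graph G"
proof -
  have "finite (parcs G)"
    using assms by (meson finite_SigmaI finite_subset)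
  then show ?thesis
    using assms by unfold_locales (auto simp: symmetric_def irrefl_def)
qed

lemma pair_graph_parcsD:
  assumes "pair_graph G"
  shows "finite (pverts G)" and "parcs G \<subseteq> pverts G \<times> pverts G"
    and "sym (parcs G)" and "irrefl (parcs G)"
proof -
  interpret pair_graph G by fact
  show "finite (pverts G)" by (rule pair_finite_verts)
  show "parcs G \<subseteq> pverts G \<times> pverts G" by (auto dest: in_arcsD1 in_arcsD2)
  show "sym (parcs G)" using pair_sym_arcs by (simp add: symmetric_def)
  show "irrefl (parcs G)" using pair_no_loops by (fastforce simp: irrefl_def)
qed

text \<open>By symmetry of the arcs, any two vertices are linked through the base point
  \<open>u\<close>.\<close>

lemma connected_pair_graphI:
  assumes "pair_graph G" and "u \<in> pverts G"
    and reach: "\<And>v. v \<in> pverts G \<Longrightarrow> (u, v) \<in> (parcs G)\<^sup>*"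
  shows "Digraph_Component.connected (with_proj G)"
proof -
  have "sym ((parcs G)\<^sup>*)"
    using pair_graph_parcsD[OF assms(1)] by (simp add: sym_rtrancl)
  then have "(v, w) \<in> (parcs G)\<^sup>*" if "v \<in> pverts G" "w \<in> pverts G" for v w
    using reach[OF that(1)] reach[OF that(2)] by (meson rtrancl_trans symD)
  then show ?thesis
    using connected_pair_graph_iff[OF assms(1)] assms(2) by blast
qed

text \<open>Provides the constituents of the join and coproduct decompositions below.\<close>

definition induced_pair_graph :: "'v pair_pre_digraph \<Rightarrow> 'v set \<Rightarrow> 'v pair_pre_digraph" where
  "induced_pair_graph G S = \<lparr> pverts = S, parcs = parcs G \<inter> S \<times> S \<rparr>"

lemma pair_graph_induced:
  assumes "pair_graph G" and "S \<subseteq> pverts G"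
  shows "pair_graph (induced_pair_graph G S)"
  using pair_graph_parcsD[OF assms(1)] assms(2)
  by (intro pair_graphI) (auto simp: induced_pair_graph_def irrefl_def sym_def intro: finite_subset)

lemma induced_singleton:
  assumes "pair_graph G"
  shows "induced_pair_graph G {p} = \<lparr> pverts = {p}, parcs = {} \<rparr>"
  using pair_graph_parcsD[OF assms] by (auto simp: induced_pair_graph_def irrefl_def)

lemma complete_digraph_1_iff:
  "complete_digraph 1 (with_proj P) \<longleftrightarrow> (\<exists>p. P = \<lparr> pverts = {p}, parcs = {} \<rparr>)"
  unfolding complete_digraph_pair_def
  by (cases P) (auto simp: card_1_singleton_iff)

text \<open>
  The sets that, besides the lines, turn out to be the proper flats with at least two points.
\<close>

definition dominating_anticlique :: "'v pair_pre_digraph \<Rightarrow> 'v set \<Rightarrow> bool" where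
  "dominating_anticlique G A \<longleftrightarrow>
     A \<subset> pverts G \<and> (\<exists>p\<in>A. \<exists>q\<in>A. p \<noteq> q) \<and> parcs G \<inter> A \<times> A = {} \<and>
     (\<forall>z\<in>pverts G - A. \<forall>a\<in>A. \<forall>b\<in>A. a \<noteq> b \<longrightarrow> (a, z) \<in> parcs G \<or> (b, z) \<in> parcs G)"

text \<open>Fix \<open>p\<close> and \<open>q\<close> in \<open>A\<close>: \<open>p\<close> reaches
  the rest of \<open>A\<close> in one arc, and a vertex outside is adjacent to \<open>p\<close> or
  to \<open>q\<close>. Applied with \<open>G'\<close> the graph of flats, in which the flat
  \<open>A\<close> is a clique.\<close>

lemma connected_if_clique_on_dominating_anticlique:
  assumes "dominating_anticlique G A" and "pair_graph G'"
    and "pverts G' = pverts G" and "parcs G \<subseteq> parcs G'"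
    and clique: "\<And>a b. a \<in> A \<Longrightarrow> b \<in> A \<Longrightarrow> a \<noteq> b \<Longrightarrow> (a, b) \<in> parcs G'"
  shows "Digraph_Component.connected (with_proj G')"
proof -
  obtain p q where pq: "p \<in> A" "q \<in> A" "p \<noteq> q"
    using assms(1) by (auto simp: dominating_anticlique_def)
  have "(p, v) \<in> (parcs G')\<^sup>*" if "v \<in> pverts G" for v
  proof (cases "v \<in> A")
    case True
    then show ?thesis using clique[OF pq(1)] by (cases "v = p") auto
  next
    case False
    then have "(p, v) \<in> parcs G' \<or> (q, v) \<in> parcs G'"
      using assms(1,4) pq that unfolding dominating_anticlique_def by blast
    then show ?thesis using clique[OF pq] by (meson r_into_rtrancl rtrancl.intros)
  qed
  then show ?thesis
    using connected_pair_graphI[OF assms(2), of p] pq(1) assms(1,3)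
    by (auto simp: dominating_anticlique_def)
qed

section \<open>Dominating anticliques and the classes \<open>Omega1\<close> and
  \<open>Omega2\<close>\<close>

lemma Omega1_dominating_anticlique:
  assumes "G \<in> Omega1" and "parcs G \<noteq> {}"
  shows "\<exists>A. dominating_anticlique G A"
proof -
  obtain n N D P where G: "G = graph_coproduct (graph_join N D) P"
    and n: "n \<ge> 1" and N: "edgeless_graph n N" and D: "pair_graph D"
    and P: "complete_digraph 1 (with_proj P)" and ND: "disjoint_graphs N D"
    and NDP: "disjoint_graphs (graph_join N D) P"
    using assms(1) unfolding Omega1_def by blast
  obtain x where x: "P = \<lparr> pverts = {x}, parcs = {} \<rparr>"
    using P unfolding complete_digraph_1_iff by auto
  have "pverts N \<noteq> {}" and N': "parcs N = {}"
    using n N by (auto simp: edgeless_graph_def)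
  then obtain p where p: "p \<in> pverts N" by auto
  note defs = graph_coproduct_def graph_join_def disjoint_graphs_def
  \<comment> \<open>Otherwise \<open>G\<close> would have no arcs. Hence the anticlique chosen below
    is a proper subset.\<close>
  have "pverts D \<noteq> {}"
    using assms(2) pair_graph_parcsD(2)[OF D] N' x by (auto simp: G defs)
  then obtain z where z: "z \<in> pverts D" by auto
  \<comment> \<open>The vertices outside are those of \<open>D\<close>; each is adjacent to all of
    \<open>N\<close> and misses only \<open>x\<close>.\<close>
  have "dominating_anticlique G (insert x (pverts N))"
    using p z ND NDP pair_graph_parcsD(2)[OF D] N'
    unfolding dominating_anticlique_def G x defs by fastforce
  then show ?thesis ..
qed

lemma Omega2_dominating_anticlique:
  assumes "G \<in> Omega2" and "parcs G \<noteq> {}"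
  shows "\<exists>A. dominating_anticlique G A"
proof -
  obtain P D P' D' where G: "G = graph_coproduct (graph_join P D) (graph_join P' D')"
    and P: "complete_digraph 1 (with_proj P)" "complete_digraph 1 (with_proj P')"
    and D: "pair_graph D" "pair_graph D'"
    and disj: "disjoint_graphs P D" "disjoint_graphs P' D'"
      "disjoint_graphs (graph_join P D) (graph_join P' D')"
    using assms(1) unfolding Omega2_def by blast
  obtain x y where x: "P = \<lparr> pverts = {x}, parcs = {} \<rparr>" "P' = \<lparr> pverts = {y}, parcs = {} \<rparr>"
    using P complete_digraph_1_iff by metis
  note defs = graph_coproduct_def graph_join_def disjoint_graphs_def
  have "pverts D \<union> pverts D' \<noteq> {}"
    using assms(2) pair_graph_parcsD(2)[OF D(1)] pair_graph_parcsD(2)[OF D(2)] x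
    by (auto simp: G defs)
  then obtain z where z: "z \<in> pverts D \<union> pverts D'" by auto
  \<comment> \<open>These are the apexes of the two cones; every other vertex is adjacent to the
    apex of its own cone.\<close>
  have "dominating_anticlique G {x, y}"
    using z disj pair_graph_parcsD(2)[OF D(1)] pair_graph_parcsD(2)[OF D(2)]
    unfolding dominating_anticlique_def G x defs by fastforce
  then show ?thesis ..
qed

text \<open>Since \<open>x\<close> has no neighbours, domination for the pair \<open>x\<close>,
  \<open>a\<close> forces \<open>a\<close> to be adjacent to every vertex outside \<open>A\<close>.
  So \<open>A - {x}\<close> is the edgeless part, fully joined to the complement of
  \<open>A\<close>, and \<open>x\<close> is the extra component.\<close>

lemma Omega1_if_isolated_vertex:
  assumes G: "pair_graph G" and A: "dominating_anticlique G A"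
    and "x \<in> A" and isolated: "\<And>z. (x, z) \<notin> parcs G"
  shows "G \<in> Omega1"
proof -
  note g = pair_graph_parcsD[OF G]
  note dom = A[unfolded dominating_anticlique_def]
  let ?N = "induced_pair_graph G (A - {x})"
  let ?D = "induced_pair_graph G (pverts G - A)"
  let ?P = "induced_pair_graph G {x}"
  have "finite A" using dom g(1) by (auto intro: finite_subset)
  have "\<exists>p\<in>A. \<exists>q\<in>A. p \<noteq> q" using dom by simp
  then have "A - {x} \<noteq> {}" by blast
  then have n: "card (A - {x}) \<ge> 1"
    using \<open>finite A\<close> by (metis card_0_eq finite_Diff less_one not_le)
  have adj: "(a, z) \<in> parcs G" "(z, a) \<in> parcs G"
    if "a \<in> A - {x}" "z \<in> pverts G - A" for a z
  proof -
    have "a \<in> A" "a \<noteq> x" using that by auto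
    then show "(a, z) \<in> parcs G" using dom isolated that(2) \<open>x \<in> A\<close> by metis
    then show "(z, a) \<in> parcs G" by (rule symD[OF g(3)])
  qed
  have isolated': "(z, x) \<notin> parcs G" for z
    using isolated symD[OF g(3)] by blast
  have "pair_graph ?N" and D: "pair_graph ?D"
    using dom by (auto intro!: pair_graph_induced[OF G])
  then have N: "edgeless_graph (card (A - {x})) ?N"
    using dom by (auto simp: edgeless_graph_def induced_pair_graph_def)
  have P: "complete_digraph 1 (with_proj ?P)"
    using induced_singleton[OF G] complete_digraph_1_iff by auto
  have disj: "disjoint_graphs ?N ?D" "disjoint_graphs (graph_join ?N ?D) ?P"
    using \<open>x \<in> A\<close> by (auto simp: disjoint_graphs_def graph_join_def induced_pair_graph_def)
  have "parcs G = parcs (graph_coproduct (graph_join ?N ?D) ?P)"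
    using adj isolated isolated' dom g(2)
    by (auto simp: graph_coproduct_def graph_join_def induced_pair_graph_def)
  moreover have "pverts G = pverts (graph_coproduct (graph_join ?N ?D) ?P)"
    using dom \<open>x \<in> A\<close>
    by (auto simp: graph_coproduct_def graph_join_def induced_pair_graph_def)
  ultimately have "G = graph_coproduct (graph_join ?N ?D) ?P"
    by simp
  then show ?thesis
    unfolding Omega1_def using n N D P disj by blast
qed

text \<open>
  If \<open>A\<close> has three vertices, any two vertices outside \<open>A\<close> have a common neighbour in \<open>A\<close>, so only
  an isolated vertex in \<open>A\<close> can make the graph disconnected.
\<close>

lemma isolated_vertex_if_not_connected:
  assumes G: "pair_graph G" and A: "dominating_anticlique G A"
    and abc: "a \<in> A" "b \<in> A" "c \<in> A" "a \<noteq> b" "a \<noteq> c" "b \<noteq> c"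
    and disc: "\<not> Digraph_Component.connected (with_proj G)"
  shows "\<exists>x\<in>A. \<forall>z. (x, z) \<notin> parcs G"
proof (rule ccontr)
  assume "\<not> ?thesis"
  then have nbr: "\<exists>z. (x, z) \<in> parcs G" if "x \<in> A" for x using that by auto
  note g = pair_graph_parcsD[OF G]
  note dom = A[unfolded dominating_anticlique_def]
  obtain z0 where z0: "z0 \<in> pverts G - A" using dom by auto
  have out: "(z0, w) \<in> (parcs G)\<^sup>*" if "w \<in> pverts G - A" for w
  proof -
    \<comment> \<open>Each of \<open>z0\<close> and \<open>w\<close> is non-adjacent to at most one
      of \<open>a\<close>, \<open>b\<close>, \<open>c\<close>, so one of the three is adjacent to
      both.\<close>
    have "\<exists>x\<in>A. (x, z0) \<in> parcs G \<and> (x, w) \<in> parcs G"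
      using dom z0 that abc by metis
    then show ?thesis
      using g(3) by (meson symD r_into_rtrancl rtrancl.intros)
  qed
  have "(z0, v) \<in> (parcs G)\<^sup>*" if "v \<in> pverts G" for v
  proof (cases "v \<in> A")
    case True
    then obtain z where z: "(v, z) \<in> parcs G" using nbr by auto
    then have "z \<in> pverts G - A" using True dom g(2) by auto
    then show ?thesis using out z g(3) by (meson symD rtrancl.rtrancl_into_rtrancl)
  qed (use out that in auto)
  then show False
    using disc z0 connected_pair_graphI[OF G, of z0] by blast
qed

text \<open>\<open>p\<close> and \<open>q\<close> are the apexes of two cones over their
  neighbourhoods. A common neighbour, or an arc between the neighbourhoods, would give a path from
  \<open>p\<close> to \<open>q\<close>.\<close>

lemma Omega2_if_not_connected:
  assumes G: "pair_graph G" and A: "dominating_anticlique G {p, q}" and "p \<noteq> q"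
    and disc: "\<not> Digraph_Component.connected (with_proj G)"
  shows "G \<in> Omega2"
proof -
  note g = pair_graph_parcsD[OF G]
  note dom = A[unfolded dominating_anticlique_def]
  have refl: "(z, z) \<notin> parcs G" for z using g(4) by (auto simp: irrefl_def)
  have nadj: "(p, q) \<notin> parcs G" "(q, p) \<notin> parcs G" using dom by auto
  have cover: "(p, v) \<in> parcs G \<or> (q, v) \<in> parcs G" if "v \<in> pverts G" "v \<noteq> p" "v \<noteq> q" for v
    using dom that \<open>p \<noteq> q\<close> by blast
  \<comment> \<open>Every other vertex is adjacent to \<open>p\<close> or \<open>q\<close>, so such
    a path would connect the whole graph.\<close>
  have no_path: "(p, q) \<notin> (parcs G)\<^sup>*"
  proof
    assume pq: "(p, q) \<in> (parcs G)\<^sup>*"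
    have "(p, v) \<in> (parcs G)\<^sup>*" if "v \<in> pverts G" for v
      using cover[OF that] pq rtrancl_into_rtrancl[OF pq] by auto
    moreover have "p \<in> pverts G" using dom by auto
    ultimately show False
      using disc connected_pair_graphI[OF G, of p] by blast
  qed
  let ?S = "{v. (p, v) \<in> parcs G}" and ?T = "{v. (q, v) \<in> parcs G}"
  let ?P = "induced_pair_graph G {p}" and ?P' = "induced_pair_graph G {q}"
  let ?D = "induced_pair_graph G ?S" and ?D' = "induced_pair_graph G ?T"
  have no_common: "\<not> (v \<in> ?S \<and> v \<in> ?T)" for v
  proof
    assume "v \<in> ?S \<and> v \<in> ?T"
    then have "(p, v) \<in> parcs G" "(v, q) \<in> parcs G" using g(3) by (auto dest: symD)
    then show False using no_path by (meson r_into_rtrancl rtrancl.rtrancl_into_rtrancl)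
  qed
  have no_cross: "(s, t) \<notin> parcs G" "(t, s) \<notin> parcs G" if "s \<in> ?S" "t \<in> ?T" for s t
  proof -
    show "(s, t) \<notin> parcs G"
    proof
      assume "(s, t) \<in> parcs G"
      then have "(p, t) \<in> (parcs G)\<^sup>*"
        using that by (meson mem_Collect_eq r_into_rtrancl rtrancl.rtrancl_into_rtrancl)
      moreover have "(t, q) \<in> parcs G" using that g(3) by (auto dest: symD)
      ultimately show False using no_path rtrancl_into_rtrancl by metis
    qed
    then show "(t, s) \<notin> parcs G" using g(3) by (auto dest: symD)
  qed
  have D: "pair_graph ?D" "pair_graph ?D'"
    using g(2) by (auto intro!: pair_graph_induced[OF G])
  have P: "complete_digraph 1 (with_proj ?P)" "complete_digraph 1 (with_proj ?P')"
    using induced_singleton[OF G] complete_digraph_1_iff by auto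
  have disj: "disjoint_graphs ?P ?D" "disjoint_graphs ?P' ?D'"
    "disjoint_graphs (graph_join ?P ?D) (graph_join ?P' ?D')"
    using refl nadj no_common \<open>p \<noteq> q\<close>
    by (auto simp: disjoint_graphs_def graph_join_def induced_pair_graph_def)
  have V: "pverts G = {p} \<union> ?S \<union> ({q} \<union> ?T)"
    using dom cover g(2) by auto
  have "parcs G = parcs (graph_coproduct (graph_join ?P ?D) (graph_join ?P' ?D'))" (is "_ = ?E")
  proof -
    have E: "?E = parcs G \<inter> ?S \<times> ?S \<union> {p} \<times> ?S \<union> ?S \<times> {p} \<union>
      (parcs G \<inter> ?T \<times> ?T \<union> {q} \<times> ?T \<union> ?T \<times> {q})"
      using refl by (auto simp: graph_coproduct_def graph_join_def induced_pair_graph_def)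
    have "?E \<subseteq> parcs G"
      unfolding E by (auto intro: symD[OF g(3)])
    moreover have "(u, v) \<in> ?E" if uv: "(u, v) \<in> parcs G" for u v
    proof -
      have vu: "(v, u) \<in> parcs G" using uv by (rule symD[OF g(3)])
      have "u \<in> {p} \<union> ?S \<union> ({q} \<union> ?T)" "v \<in> {p} \<union> ?S \<union> ({q} \<union> ?T)"
        using V g(2) uv by auto
      then consider "u = p" | "u = q" | "v = p" | "v = q"
        | "u \<in> ?S" "v \<in> ?S" | "u \<in> ?T" "v \<in> ?T"
        | "u \<in> ?S" "v \<in> ?T" | "u \<in> ?T" "v \<in> ?S"
        by blast
      then show ?thesis
        unfolding E using uv vu no_cross by cases blast+
    qed
    ultimately show ?thesis by auto
  qed
  moreover have "pverts G = pverts (graph_coproduct (graph_join ?P ?D) (graph_join ?P' ?D'))"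
    unfolding V by (simp add: graph_coproduct_def graph_join_def induced_pair_graph_def)
  ultimately have "G = graph_coproduct (graph_join ?P ?D) (graph_join ?P' ?D')"
    by simp
  then show ?thesis
    unfolding Omega2_def using D P disj by blast
qed

text \<open>An anticlique of two vertices leads to \<open>Omega2\<close>; a larger one contains an
  isolated vertex and leads to \<open>Omega1\<close>.\<close>

lemma dominating_anticlique_imp_Omega:
  assumes G: "pair_graph G" and A: "dominating_anticlique G A"
    and disc: "\<not> Digraph_Component.connected (with_proj G)"
  shows "G \<in> Omega1 \<union> Omega2"
proof -
  obtain p q where pq: "p \<in> A" "q \<in> A" "p \<noteq> q"
    using A by (auto simp: dominating_anticlique_def)
  show ?thesis
  proof (cases "A = {p, q}")
    case True
    then show ?thesis using Omega2_if_not_connected[OF G _ pq(3) disc] A by simp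
  next
    case False
    then obtain c where "c \<in> A" "p \<noteq> c" "q \<noteq> c" using pq by auto
    then show ?thesis
      using isolated_vertex_if_not_connected[OF G A pq(1,2) _ pq(3) _ _ disc]
        Omega1_if_isolated_vertex[OF G A] by blast
  qed
qed

section \<open>Independence\<close>

text \<open>The new element takes index 0 and the old indices shift by one, as when a first row and
  column are put in front of a triangular matrix.\<close>

lemma bij_betw_case_nat:
  assumes "bij_betw f {..<n} S" and "s \<notin> S"
  shows "bij_betw (case_nat s f) {..<Suc n} (insert s S)"
proof -
  have f: "inj_on f {..<n}" "f ` {..<n} = S" using assms(1) by (auto simp: bij_betw_def)
  have "inj_on (case_nat s f \<circ> Suc) {..<n}" using f(1) by (simp add: comp_def)
  then have "inj_on (case_nat s f) (Suc ` {..<n})" by (rule inj_on_imageI)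
  moreover have "case_nat s f ` Suc ` {..<n} = S" using f(2) by (simp add: image_image)
  ultimately show ?thesis
    unfolding bij_betw_def lessThan_Suc_eq_insert_0 using assms(2) by simp
qed

text \<open>Row \<open>r\<close> is 1 at \<open>x\<close> and 0 on \<open>X\<close>, so it can go on
  top with \<open>x\<close> as first column. The rest of that column lies below the diagonal, where
  entries are arbitrary.\<close>

lemma matrix_independent_insert:
  assumes "matrix_independent R V M X" and "x \<in> V" "x \<notin> X" and "r \<in> R"
    and "M r x" and zero: "\<And>z. z \<in> X \<Longrightarrow> \<not> M r z"
  shows "matrix_independent R V M (insert x X)"
proof -
  obtain Y y c and n :: nat where Y: "Y \<subseteq> R" and y: "bij_betw y {..<n} Y" and c: "bij_betw c {..<n} X"
    and diag: "\<forall>i<n. M (y i) (c i)" and upper: "\<forall>i<n. \<forall>j<n. i < j \<longrightarrow> \<not> M (y i) (c j)"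
    using assms(1) unfolding matrix_independent_def nonsingular_submatrix_def by blast
  have cX: "c i \<in> X" if "i < n" for i using c that by (auto simp: bij_betw_def)
  \<comment> \<open>Each row in \<open>Y\<close> has its diagonal 1 in a column of \<open>X\<close>,
    where \<open>r\<close> vanishes.\<close>
  have "r \<notin> Y"
    using y diag zero cX unfolding bij_betw_def by (metis imageE lessThan_iff)
  have "nonsingular_submatrix M (insert r Y) (insert x X)"
    unfolding nonsingular_submatrix_def
  proof (intro exI conjI allI impI)
    show "bij_betw (case_nat r y) {..<Suc n} (insert r Y)"
      by (rule bij_betw_case_nat[OF y \<open>r \<notin> Y\<close>])
    show "bij_betw (case_nat x c) {..<Suc n} (insert x X)"
      by (rule bij_betw_case_nat[OF c \<open>x \<notin> X\<close>])
  next
    fix i assume "i < Suc n"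
    then show "M (case_nat r y i) (case_nat x c i)"
      using diag \<open>M r x\<close> by (cases i) auto
  next
    fix i j assume "i < Suc n" "j < Suc n" "i < j"
    then show "\<not> M (case_nat r y i) (case_nat x c j)"
      using upper zero cX by (cases i; cases j) auto
  qed
  then show ?thesis
    using assms(1,2,4) Y unfolding matrix_independent_def by (metis insert_subset)
qed

text \<open>The first row of the triangular form has its diagonal 1 followed only by zeros.\<close>

lemma matrix_independent_pivot:
  assumes "matrix_independent R V M X" and "X \<noteq> {}"
  shows "\<exists>x\<in>X. \<exists>r\<in>R. M r x \<and> (\<forall>z\<in>X - {x}. \<not> M r z)"
proof -
  obtain Y y c and n :: nat where Y: "Y \<subseteq> R" and y: "bij_betw y {..<n} Y" and c: "bij_betw c {..<n} X"
    and diag: "\<forall>i<n. M (y i) (c i)" and upper: "\<forall>i<n. \<forall>j<n. i < j \<longrightarrow> \<not> M (y i) (c j)"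
    using assms(1) unfolding matrix_independent_def nonsingular_submatrix_def by blast
  have "n > 0" using c assms(2) by (cases n) (auto simp: bij_betw_def)
  have "\<not> M (y 0) z" if "z \<in> X - {c 0}" for z
  proof -
    have "z \<in> c ` {..<n}" using c that by (simp add: bij_betw_def)
    then obtain j where "j < n" "z = c j" by auto
    then show ?thesis using upper \<open>n > 0\<close> that by (cases j) auto
  qed
  moreover have "c 0 \<in> X" "y 0 \<in> R" "M (y 0) (c 0)"
    using \<open>n > 0\<close> c y Y diag by (auto simp: bij_betw_def)
  ultimately show ?thesis by blast
qed

section \<open>Flats of a representable complex of dimension two\<close>

locale plane_representation =
  fixes R :: "'r set" and V :: "'v set" and M :: "'r \<Rightarrow> 'v \<Rightarrow> bool" and H :: "'v set set"
  assumes simple: "simple_complex V H"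
    and dim: "complex_dim H = 2"
    and rep: "boolean_matrix_representation R V M H"
begin

abbreviation "LL \<equiv> matrix_lines R V M"
abbreviation "\<Gamma>M \<equiv> matrix_graph R V M"
abbreviation "\<Gamma>Fl \<equiv> flat_graph V H"

section \<open>Faces and lines\<close>

lemma finite_V: "finite V" and finite_H: "finite H" and H_subset: "I \<in> H \<Longrightarrow> I \<subseteq> V"
  and empty_H: "{} \<in> H"
  and singleton_H: "a \<in> V \<Longrightarrow> {a} \<in> H"
  using simple unfolding simple_complex_def simplicial_complex_def
  by (auto intro: finite_subset)

lemma pair_H: "a \<in> V \<Longrightarrow> b \<in> V \<Longrightarrow> {a, b} \<in> H"
  using simple singleton_H[of a] unfolding simple_complex_def by (cases "a = b") auto

lemma H_iff: "X \<in> H \<longleftrightarrow> matrix_independent R V M X"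
  using rep unfolding boolean_matrix_representation_def by auto

lemma card_face_le: "I \<in> H \<Longrightarrow> card I \<le> 3"
proof -
  assume "I \<in> H"
  then have "face_dim I \<le> 2"
    using dim finite_H unfolding complex_dim_def by (metis Max_ge finite_imageI imageI)
  then show ?thesis by (simp add: face_dim_def)
qed

lemma ex_triple_face: "\<exists>I\<in>H. card I = 3"
proof -
  have "2 \<in> face_dim ` H"
    using dim finite_H empty_H unfolding complex_dim_def
    by (metis Max_in empty_iff finite_imageI image_is_empty)
  then show ?thesis by (force simp: face_dim_def)
qed

lemma zero_set_in_lines:
  assumes "r \<in> R" "a \<in> V" "b \<in> V" "c \<in> V" "a \<noteq> b" "\<not> M r a" "\<not> M r b" "M r c"
  shows "zero_set V M r \<in> LL"
proof -
  have "{a, b} \<subseteq> zero_set V M r" "zero_set V M r \<subset> V"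
    using assms by (auto simp: zero_set_def)
  then have "2 \<le> card (zero_set V M r)" "card (zero_set V M r) < card V"
    using finite_V card_mono[of "zero_set V M r" "{a, b}"] assms(5)
    by (auto simp: psubset_card_mono finite_subset)
  then show ?thesis using assms(1) unfolding matrix_lines_def by auto
qed

lemma line_psubset: "L \<in> LL \<Longrightarrow> L \<subset> V"
  unfolding matrix_lines_def by (auto simp: zero_set_def)

text \<open>The row defining \<open>L\<close> is 0 on \<open>I\<close> and 1 at \<open>p\<close>, so
  it can be the new first row in \<open>matrix_independent_insert\<close>.\<close>

lemma face_extend:
  assumes "L \<in> LL" "I \<in> H" "I \<subseteq> L" "p \<in> V - L"
  shows "insert p I \<in> H"
proof -
  obtain r where "r \<in> R" "L = zero_set V M r"
    using assms(1) unfolding matrix_lines_def by auto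
  then show ?thesis
    using assms(2-4) matrix_independent_insert[of R V M I p r]
    by (auto simp: H_iff zero_set_def)
qed

text \<open>Such a face would extend by a point off \<open>L\<close> to a face with four vertices,
  exceeding the dimension.\<close>

lemma no_triple_in_line:
  assumes "L \<in> LL" "a \<in> L" "b \<in> L" "c \<in> L" "a \<noteq> b" "a \<noteq> c" "b \<noteq> c"
  shows "{a, b, c} \<notin> H"
proof
  assume abc: "{a, b, c} \<in> H"
  obtain p where p: "p \<in> V - L" using line_psubset[OF assms(1)] by auto
  then have "insert p {a, b, c} \<in> H" using face_extend[OF assms(1) abc] assms by auto
  then have "card (insert p {a, b, c}) \<le> 3" by (rule card_face_le)
  moreover have "p \<notin> {a, b, c}" using p assms by auto
  ultimately show False using assms by simp
qed

lemma line_unique: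
  assumes "L \<in> LL" "L' \<in> LL" "a \<in> L \<inter> L'" "b \<in> L \<inter> L'" "a \<noteq> b"
  shows "L = L'"
proof -
  \<comment> \<open>Stated for arbitrary \<open>K\<close> and \<open>K'\<close> so that exchanging
    the two lines gives both inclusions. A point \<open>c\<close> of \<open>K\<close> off
    \<open>K'\<close> would make \<open>{a, b, c}\<close> a face inside \<open>K\<close>.\<close>
  have "c \<in> K'" if KK: "K \<in> LL" "K' \<in> LL" "a \<in> K \<inter> K'" "b \<in> K \<inter> K'" "c \<in> K" for K K' c
  proof (rule ccontr)
    assume "c \<notin> K'"
    then have "insert c {a, b} \<in> H"
      using face_extend[OF KK(2) pair_H] KK line_psubset by blast
    moreover have "{c, a, b} \<notin> H"
      using no_triple_in_line[OF KK(1)] KK \<open>c \<notin> K'\<close> \<open>a \<noteq> b\<close> by blast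
    ultimately show False by simp
  qed
  then show ?thesis using assms by blast
qed

text \<open>A pivot row of the triple is 1 at one vertex and 0 at the other two, so its zero set is
  a line through those two.\<close>

lemma triple_face_line:
  assumes "{a, b, c} \<in> H" "a \<noteq> b" "a \<noteq> c" "b \<noteq> c"
  shows "\<exists>L\<in>LL. (a \<in> L \<and> b \<in> L) \<or> (a \<in> L \<and> c \<in> L) \<or> (b \<in> L \<and> c \<in> L)"
proof -
  have V: "a \<in> V" "b \<in> V" "c \<in> V" using H_subset[OF assms(1)] by auto
  obtain x r where r: "x \<in> {a, b, c}" "r \<in> R" "M r x" "\<forall>z\<in>{a, b, c} - {x}. \<not> M r z"
    using matrix_independent_pivot[of R V M "{a, b, c}"] assms(1) H_iff by auto
  have "zero_set V M r \<in> LL"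
  proof -
    obtain u v where "u \<in> {a, b, c} - {x}" "v \<in> {a, b, c} - {x}" "u \<noteq> v"
      using r(1) assms by auto
    then show ?thesis using r V zero_set_in_lines[of r u v x] by auto
  qed
  moreover have "{a, b, c} - {x} \<subseteq> zero_set V M r"
    using r(4) V by (auto simp: zero_set_def)
  ultimately obtain L where L: "L \<in> LL" "{a, b, c} - {x} \<subseteq> L" by blast
  have "x = a \<or> x = b \<or> x = c" using r(1) by simp
  then have "(a \<in> L \<and> b \<in> L) \<or> (a \<in> L \<and> c \<in> L) \<or> (b \<in> L \<and> c \<in> L)"
    using L(2) assms(2-4) by auto
  then show ?thesis using L(1) by blast
qed

section \<open>The graph of the matrix\<close>

lemma parcs_\<Gamma>M: "(a, b) \<in> parcs \<Gamma>M \<longleftrightarrow> a \<noteq> b \<and> (\<exists>L\<in>LL. a \<in> L \<and> b \<in> L)"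
  by (auto simp: matrix_graph_def)

lemma pverts_\<Gamma>M: "pverts \<Gamma>M = V"
  by (simp add: matrix_graph_def)

lemma pair_graph_\<Gamma>M: "pair_graph \<Gamma>M"
proof (rule pair_graphI)
  show "parcs \<Gamma>M \<subseteq> pverts \<Gamma>M \<times> pverts \<Gamma>M"
    using line_psubset by (fastforce simp: parcs_\<Gamma>M pverts_\<Gamma>M)
qed (auto simp: parcs_\<Gamma>M pverts_\<Gamma>M finite_V sym_def irrefl_def)

text \<open>Dimension two supplies a face with three vertices, hence a line. This excludes the
  edgeless members of \<open>Omega1\<close> and \<open>Omega2\<close>.\<close>

lemma parcs_\<Gamma>M_nonempty: "parcs \<Gamma>M \<noteq> {}"
proof -
  obtain I where I: "I \<in> H" "card I = 3" using ex_triple_face by auto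
  then obtain a b c where "I = {a, b, c}" "a \<noteq> b" "a \<noteq> c" "b \<noteq> c"
    unfolding card_3_iff by auto
  then show ?thesis using triple_face_line[of a b c] I(1) parcs_\<Gamma>M by auto
qed

text \<open>A line through two of the vertices cannot contain both \<open>a\<close> and
  \<open>b\<close>, so it contains \<open>c\<close> and exactly one of them. Conversely, the pair on
  such a line extends by the vertex off it.\<close>

lemma triple_face_iff:
  assumes "a \<in> V" "b \<in> V" "c \<in> V" "a \<noteq> b" "a \<noteq> c" "b \<noteq> c" and "(a, b) \<notin> parcs \<Gamma>M"
  shows "{a, b, c} \<in> H \<longleftrightarrow> (a, c) \<in> parcs \<Gamma>M \<or> (b, c) \<in> parcs \<Gamma>M"
proof
  assume "{a, b, c} \<in> H"
  then show "(a, c) \<in> parcs \<Gamma>M \<or> (b, c) \<in> parcs \<Gamma>M"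
    using triple_face_line[of a b c] assms by (auto simp: parcs_\<Gamma>M)
next
  assume "(a, c) \<in> parcs \<Gamma>M \<or> (b, c) \<in> parcs \<Gamma>M"
  then consider L where "L \<in> LL" "a \<in> L" "c \<in> L" | L where "L \<in> LL" "b \<in> L" "c \<in> L"
    by (auto simp: parcs_\<Gamma>M)
  then show "{a, b, c} \<in> H"
  proof cases
    case 1
    then have "b \<notin> L" using assms by (auto simp: parcs_\<Gamma>M)
    then have "insert b {a, c} \<in> H" using face_extend[OF 1(1) pair_H] 1 assms by auto
    then show ?thesis by (simp add: insert_commute)
  next
    case 2
    then have "a \<notin> L" using assms by (auto simp: parcs_\<Gamma>M)
    then show ?thesis using face_extend[OF 2(1) pair_H] 2 assms by auto
  qed
qed

section \<open>Flats\<close>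

lemma is_flatI:
  assumes "F \<subseteq> V"
    and triple: "\<And>a b c. a \<in> F \<Longrightarrow> b \<in> F \<Longrightarrow> c \<in> F \<Longrightarrow> a \<noteq> b \<Longrightarrow> a \<noteq> c \<Longrightarrow> b \<noteq> c
      \<Longrightarrow> {a, b, c} \<notin> H"
    and pair: "\<And>a b p. a \<in> F \<Longrightarrow> b \<in> F \<Longrightarrow> a \<noteq> b \<Longrightarrow> p \<in> V - F \<Longrightarrow> {a, b, p} \<in> H"
  shows "is_flat V H F"
  unfolding is_flat_def
proof (intro conjI ballI impI)
  fix I p assume I: "I \<in> H" "I \<subseteq> F" and p: "p \<in> V - F"
  have "card I \<noteq> 3"
  proof
    assume "card I = 3"
    then obtain a b c where "I = {a, b, c}" "a \<noteq> b" "a \<noteq> c" "b \<noteq> c"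
      unfolding card_3_iff by auto
    then show False using triple[of a b c] I by auto
  qed
  \<comment> \<open>Faces with at most one vertex extend because the complex is simple, so only
    pairs call for the assumption \<open>pair\<close>.\<close>
  then have "card I \<in> {0, 1, 2}" using card_face_le[OF I(1)] by auto
  moreover have "finite I" using H_subset[OF I(1)] finite_V by (rule finite_subset)
  ultimately consider "I = {}" | a where "I = {a}" | a b where "I = {a, b}" "a \<noteq> b"
    by (auto simp: card_1_singleton_iff card_2_iff)
  then show "I \<union> {p} \<in> H"
  proof cases
    case 3
    then show ?thesis using pair[of a b p] I p by (simp add: insert_commute)
  qed (use p I singleton_H pair_H assms(1) in auto)
qed (rule assms(1))

lemma no_triple_in_flat:
  assumes "is_flat V H F" "F \<subset> V" "a \<in> F" "b \<in> F" "c \<in> F" "a \<noteq> b" "a \<noteq> c" "b \<noteq> c"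
  shows "{a, b, c} \<notin> H"
proof
  assume abc: "{a, b, c} \<in> H"
  obtain p where p: "p \<in> V - F" using assms(2) by auto
  then have "{a, b, c} \<union> {p} \<in> H" using assms abc unfolding is_flat_def by auto
  then have "card ({a, b, c} \<union> {p}) \<le> 3" by (rule card_face_le)
  moreover have "p \<notin> {a, b, c}" using p assms by auto
  ultimately show False using assms by simp
qed

lemma flat_extend_pair:
  assumes "is_flat V H F" "a \<in> F" "b \<in> F" "p \<in> V - F"
  shows "{a, b, p} \<in> H"
proof -
  have "{a, b} \<in> H" using assms pair_H[of a b] by (auto simp: is_flat_def)
  then have "{a, b} \<union> {p} \<in> H" using assms by (simp add: is_flat_def)
  then show ?thesis by (simp add: insert_commute)
qed

lemma line_is_flat: "L \<in> LL \<Longrightarrow> is_flat V H L"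
proof (rule is_flatI)
  fix a b p assume "L \<in> LL" "a \<in> L" "b \<in> L" "p \<in> V - L"
  then have "insert p {a, b} \<in> H"
    using face_extend[OF _ pair_H] line_psubset by blast
  then show "{a, b, p} \<in> H" by (simp add: insert_commute)
qed (use line_psubset no_triple_in_line in blast)+

text \<open>No two points of \<open>A\<close> are adjacent, so \<open>triple_face_iff\<close> turns
  the anticlique property and the domination property into the two conditions of
  \<open>is_flatI\<close>.\<close>

lemma dominating_anticlique_is_flat:
  assumes "dominating_anticlique \<Gamma>M A"
  shows "is_flat V H A"
proof (rule is_flatI)
  note dom = assms[unfolded dominating_anticlique_def pverts_\<Gamma>M]
  show "A \<subseteq> V" using dom by auto
  show "{a, b, c} \<notin> H" if "a \<in> A" "b \<in> A" "c \<in> A" "a \<noteq> b" "a \<noteq> c" "b \<noteq> c" for a b c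
    using triple_face_iff[of a b c] dom that by blast
  show "{a, b, p} \<in> H" if "a \<in> A" "b \<in> A" "a \<noteq> b" "p \<in> V - A" for a b p
    using triple_face_iff[of a b p] dom that by blast
qed

lemma flat_is_dominating_anticlique:
  assumes F: "is_flat V H F" "F \<subset> V" and pq: "p \<in> F" "q \<in> F" "p \<noteq> q" "(p, q) \<notin> parcs \<Gamma>M"
  shows "dominating_anticlique \<Gamma>M F"
proof -
  note no_triple = no_triple_in_flat[OF F]
  \<comment> \<open>A line with two points in \<open>F\<close> contains all of \<open>F\<close>: a
    point of \<open>F\<close> off the line would extend that pair to a three-vertex face inside
    \<open>F\<close>.\<close>
  have closed: "c \<in> L" if L: "L \<in> LL" "a \<in> L" "b \<in> L" "a \<in> F" "b \<in> F" "c \<in> F" "a \<noteq> b" for a b c L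
  proof (rule ccontr)
    assume "c \<notin> L"
    then have "insert c {a, b} \<in> H"
      using face_extend[OF L(1) pair_H] L F(2) by blast
    moreover have "{c, a, b} \<notin> H"
      using no_triple L \<open>c \<notin> L\<close> by blast
    ultimately show False by simp
  qed
  \<comment> \<open>Otherwise the line through \<open>a\<close> and \<open>b\<close> would contain
    both \<open>p\<close> and \<open>q\<close>, which are not adjacent.\<close>
  have anticlique: "(a, b) \<notin> parcs \<Gamma>M" if "a \<in> F" "b \<in> F" for a b
    using closed[of _ a b p] closed[of _ a b q] that pq by (auto simp: parcs_\<Gamma>M)
  have "(a, z) \<in> parcs \<Gamma>M \<or> (b, z) \<in> parcs \<Gamma>M"
    if "z \<in> V - F" "a \<in> F" "b \<in> F" "a \<noteq> b" for z a b
    using triple_face_iff[of a b z] flat_extend_pair[OF F(1)] anticlique that F(2) by blast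
  then show ?thesis
    using F(2) pq anticlique unfolding dominating_anticlique_def pverts_\<Gamma>M by blast
qed

text \<open>\<open>V\<close> is itself a flat, so the closure stays inside \<open>V\<close>; it
  misses a point exactly when some flat containing \<open>X\<close> does.\<close>

lemma flat_closure_neq_iff:
  assumes "X \<subseteq> V"
  shows "flat_closure V H X \<noteq> V \<longleftrightarrow> (\<exists>F. is_flat V H F \<and> F \<subset> V \<and> X \<subseteq> F)"
proof -
  have "is_flat V H V" by (auto simp: is_flat_def)
  then have "flat_closure V H X \<subseteq> V" using assms by (auto simp: flat_closure_def)
  then have "flat_closure V H X \<noteq> V \<longleftrightarrow> (\<exists>v\<in>V. \<exists>F. is_flat V H F \<and> X \<subseteq> F \<and> v \<notin> F)"
    unfolding flat_closure_def by blast
  also have "\<dots> \<longleftrightarrow> (\<exists>F. is_flat V H F \<and> F \<subset> V \<and> X \<subseteq> F)"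
    unfolding is_flat_def by blast
  finally show ?thesis .
qed

section \<open>Comparison of the graph of flats with the graph of the matrix\<close>

lemma pverts_\<Gamma>Fl: "pverts \<Gamma>Fl = V"
  by (simp add: flat_graph_def)

lemma parcs_\<Gamma>Fl:
  "(p, q) \<in> parcs \<Gamma>Fl \<longleftrightarrow> p \<noteq> q \<and> (\<exists>F. is_flat V H F \<and> F \<subset> V \<and> p \<in> F \<and> q \<in> F)"
  using flat_closure_neq_iff[of "{p, q}"] by (auto simp: flat_graph_def)

lemma pair_graph_\<Gamma>Fl: "pair_graph \<Gamma>Fl"
proof (rule pair_graphI)
  show "parcs \<Gamma>Fl \<subseteq> pverts \<Gamma>Fl \<times> pverts \<Gamma>Fl"
    by (auto simp: flat_graph_def)
qed (auto simp: parcs_\<Gamma>Fl pverts_\<Gamma>Fl finite_V sym_def irrefl_def)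

lemma parcs_\<Gamma>M_subset: "parcs \<Gamma>M \<subseteq> parcs \<Gamma>Fl"
  using line_is_flat line_psubset by (force simp: parcs_\<Gamma>M parcs_\<Gamma>Fl)

text \<open>Connectedness passes to a larger graph on the same vertices. In the remaining case
  \<Gamma>M has a dominating anticlique, which is a proper flat and so a clique in the graph of
  flats.\<close>

lemma connected_\<Gamma>Fl:
  assumes "Digraph_Component.connected (with_proj \<Gamma>M) \<or> \<Gamma>M \<in> Omega1 \<union> Omega2"
  shows "Digraph_Component.connected (with_proj \<Gamma>Fl)"
proof (cases "Digraph_Component.connected (with_proj \<Gamma>M)")
  case True
  then show ?thesis
    using rtrancl_mono[OF parcs_\<Gamma>M_subset]
    unfolding connected_pair_graph_iff[OF pair_graph_\<Gamma>M] connected_pair_graph_iff[OF pair_graph_\<Gamma>Fl]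
      pverts_\<Gamma>M pverts_\<Gamma>Fl by blast
next
  case False
  then obtain A where A: "dominating_anticlique \<Gamma>M A"
    using assms Omega1_dominating_anticlique Omega2_dominating_anticlique parcs_\<Gamma>M_nonempty by blast
  have "A \<subset> V" using A by (simp add: dominating_anticlique_def pverts_\<Gamma>M)
  then show ?thesis
    using dominating_anticlique_is_flat[OF A] parcs_\<Gamma>M_subset pverts_\<Gamma>M pverts_\<Gamma>Fl
    by (intro connected_if_clique_on_dominating_anticlique[OF A pair_graph_\<Gamma>Fl])
      (auto simp: parcs_\<Gamma>Fl)
qed

text \<open>For an additional arc, the proper flat containing its ends would be a dominating
  anticlique of \<Gamma>M, which the assumption rules out.\<close>

lemma \<Gamma>Fl_eq_\<Gamma>M:
  assumes "\<not> (Digraph_Component.connected (with_proj \<Gamma>M) \<or> \<Gamma>M \<in> Omega1 \<union> Omega2)"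
  shows "\<Gamma>Fl = \<Gamma>M"
proof -
  have "\<not> dominating_anticlique \<Gamma>M A" for A
    using assms dominating_anticlique_imp_Omega[OF pair_graph_\<Gamma>M] by blast
  then have "(p, q) \<in> parcs \<Gamma>M" if "(p, q) \<in> parcs \<Gamma>Fl" for p q
    using flat_is_dominating_anticlique that unfolding parcs_\<Gamma>Fl by metis
  then have "parcs \<Gamma>Fl = parcs \<Gamma>M" using parcs_\<Gamma>M_subset by (auto simp: subset_iff)
  then show ?thesis using pverts_\<Gamma>M pverts_\<Gamma>Fl by simp
qed

end

theorem theorem7p6:
  fixes R :: "'r set" and V :: "'v set" and M :: "'r \<Rightarrow> 'v \<Rightarrow> bool" and H :: "'v set set"
  assumes "simple_complex V H"
    and "complex_dim H = 2"
    and "boolean_matrix_representation R V M H"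
  shows "(Digraph_Component.connected (with_proj (matrix_graph R V M)) \<or>
            matrix_graph R V M \<in> Omega1 \<union> Omega2
          \<longrightarrow> Digraph_Component.connected (with_proj (flat_graph V H))) \<and>
         (\<not> (Digraph_Component.connected (with_proj (matrix_graph R V M)) \<or>
            matrix_graph R V M \<in> Omega1 \<union> Omega2)
          \<longrightarrow> flat_graph V H = matrix_graph R V M)"
proof -
  interpret plane_representation R V M H
    using assms by unfold_locales
  show ?thesis
    by (intro conjI impI connected_\<Gamma>Fl \<Gamma>Fl_eq_\<Gamma>M)
qed

end
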